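(* Let $n,m\in\mathbb{N}_0$ and let $\alpha,\beta$ be real numbers with $\alpha>0$ and $\alpha\beta=1$. Then $$\sum_{|j|\le n}(-1)^{n+j}\arctan\left(\left(\sqrt{1+\alpha^2\cos^2\tfrac{\pi j}{2n+1}}-\alpha\cos\tfrac{\pi j}{2n+1}\right)^{2m+1}\right)+\sum_{|k|\le m}(-1)^{m+k}\arctan\left(\left(\sqrt{1+\beta^2\cos^2\tfrac{\pi k}{2m+1}}-\beta\cos\tfrac{\pi k}{2m+1}\right)^{2n+1}\right)=\frac{\pi}{4}.$$
   Context: $\mathbb{N}_0$ denotes the non-negative integers. $\sum_{|j|\le n}$ denotes the sum over all integers $j$ with $-n\le j\le n$. $\arctan$ is the principal value, in $(-\pi/2,\pi/2)$. *)

theory Defs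
  imports Complex_Main
begin

end

theory Submission
  imports Defs
begin

text \<open>
  Each of the two sums is \<open>pi / 4\<close> minus half of a double sum of arctangents, and the two double
  sums run over reciprocal arguments.
  Put \<open>M = 2 * m + 1\<close> and \<open>d k = cos (pi * k / M)\<close>. The key expansion, which is
  \<open>arctan_radical_expansion\<close>, is
  \<open>arctan ((sqrt (1 + y\<^sup>2) - y) ^ M) = pi / 4 - (\<Sum>\<bar>k\<bar>\<le>m. (-1) ^ (m + k) * arctan (y / d k)) / 2\<close>.
  Insert it with \<open>y = \<alpha> * c j\<close>, where \<open>c j = cos (pi * j / (2 * n + 1))\<close>, into the first sum, and with
  \<open>n\<close> and \<open>m\<close> exchanged and \<open>y = \<beta> * d k\<close> into the second. Since \<open>\<alpha> * \<beta> = 1\<close>, the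
  numbers \<open>\<alpha> * c j / d k\<close> and \<open>\<beta> * d k / c j\<close> are reciprocal, and they are positive, so their
  arctangents add up to \<open>pi / 2\<close>. As the alternating signs sum to 1 over each index range, the two
  double sums together give \<open>pi / 2\<close>, and the whole is \<open>pi / 4 + pi / 4 - pi / 4\<close>.

  With \<open>y = sinh t\<close> the radical \<open>sqrt (1 + y\<^sup>2) - y\<close> is \<open>exp (- t)\<close>. Both sides of the expansion then
  agree at \<open>t = 0\<close>, and equality of their derivatives is the partial fraction decomposition of
  \<open>M / cosh (M * t)\<close> in \<open>partial_fractions_sech\<close>. That one comes from
  \<open>\<Sum> 1 / (w - z) = M * w ^ (M - 1) / (w ^ M - 1)\<close>, the sum being over the \<open>M\<close>-th roots of unity
  \<open>z\<close>: the sign \<open>(-1) ^ k\<close> turns \<open>d k\<close> into the real part of the root of unity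
  \<open>(- cis (pi / M)) ^ k\<close>.
\<close>

section \<open>Sums over symmetric integer intervals and roots of unity\<close>

lemma sum_symmetric_int_interval:
  fixes f :: "int \<Rightarrow> 'a::comm_monoid_add"
  shows "(\<Sum>k = - int m..int m. f k) = (\<Sum>l<2 * m + 1. f (int l - int m))"
  by (rule sum.reindex_bij_witness[of _ "\<lambda>l. int l - int m" "\<lambda>k. nat (k + int m)"]) auto

lemma sum_alternating_symmetric:
  "(\<Sum>k = - int m..int m. (-1) powi (int m + k)) = (1 :: real)"
proof -
  have "(\<Sum>k = - int m..int m. (-1) powi (int m + k)) = (\<Sum>l<2 * m + 1. (-1 :: real) ^ l)"
    by (simp add: sum_symmetric_int_interval)
  also have "\<dots> = 1"
    by (induction m) auto
  finally show ?thesis .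
qed

lemma sum_powi_root_of_unity_eq_0:
  fixes u :: "'a::field"
  assumes "u ^ (2 * m + 1) = 1" and "u \<noteq> 1"
  shows "(\<Sum>k = - int m..int m. u powi k) = 0"
proof -
  have "u \<noteq> 0"
    using assms(1) by auto
  then have "(\<Sum>k = - int m..int m. u powi k) = (\<Sum>l<2 * m + 1. u ^ l) / u ^ m"
    by (simp add: sum_symmetric_int_interval power_int_diff sum_divide_distrib del: sum.lessThan_Suc)
  also have "(\<Sum>l<2 * m + 1. u ^ l) = 0"
    using assms by (subst geometric_sum) simp_all
  finally show ?thesis
    by simp
qed

text \<open>
  A root of unity \<open>z\<close> of order dividing \<open>M\<close> satisfies \<open>w ^ M - 1 = w ^ M - z ^ M\<close>, so
  \<open>(w ^ M - 1) / (w - z)\<close> is a geometric sum in \<open>w\<close> and \<open>z\<close>. Summing over all \<open>z\<close> kills every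
  power of \<open>z\<close> except the zeroth.
\<close>
lemma sum_inverse_diff_roots_of_unity:
  fixes \<omega> w :: "'a::field"
  assumes root: "\<omega> ^ (2 * m + 1) = 1"
    and primitive: "\<And>i. 0 < i \<Longrightarrow> i < 2 * m + 1 \<Longrightarrow> \<omega> ^ i \<noteq> 1"
    and w: "w ^ (2 * m + 1) \<noteq> 1"
  shows "(\<Sum>k = - int m..int m. 1 / (w - \<omega> powi k)) = of_nat (2 * m + 1) * w ^ (2 * m) / (w ^ (2 * m + 1) - 1)"
proof -
  define M where "M = 2 * m + 1"
  have expand: "1 / (w - \<omega> powi k) = (\<Sum>i<M. w ^ (M - Suc i) * (\<omega> ^ i) powi k) / (w ^ M - 1)" for k
  proof -
    have pow: "(\<omega> powi k) ^ i = (\<omega> ^ i) powi k" for i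
      by (metis power_int_mult power_int_of_nat mult.commute)
    have one: "(\<omega> powi k) ^ M = 1"
      unfolding pow using root by (simp only: M_def power_int_1_left)
    have ne: "w \<noteq> \<omega> powi k"
      using one w M_def by metis
    have "w ^ M - 1 = (w - \<omega> powi k) * (\<Sum>i<M. w ^ (M - Suc i) * (\<omega> ^ i) powi k)"
    proof -
      have "1 - w ^ M = (\<omega> powi k - w) * (\<Sum>i<M. w ^ (M - Suc i) * (\<omega> powi k) ^ i)"
        using power_diff_sumr2[of "\<omega> powi k" M w] one by simp
      then show ?thesis
        by (simp add: pow algebra_simps)
    qed
    moreover have "w ^ M - 1 \<noteq> 0"
      using w M_def by simp
    ultimately show ?thesis
      using ne by (simp add: field_simps)
  qed
  have inner: "(\<Sum>k = - int m..int m. (\<omega> ^ i) powi k) = (if i = 0 then of_nat M else 0)" if "i < M" for i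
  proof (cases "i = 0")
    case True
    then show ?thesis
      by (simp add: M_def)
  next
    case False
    have "(\<omega> ^ i) ^ (2 * m + 1) = 1"
      by (metis root power_mult mult.commute power_one)
    then show ?thesis
      using sum_powi_root_of_unity_eq_0[of "\<omega> ^ i" m] primitive[of i] False that M_def by simp
  qed
  have "(\<Sum>k = - int m..int m. 1 / (w - \<omega> powi k))
      = (\<Sum>i<M. w ^ (M - Suc i) * (\<Sum>k = - int m..int m. (\<omega> ^ i) powi k)) / (w ^ M - 1)"
    unfolding expand sum_divide_distrib[symmetric]
    by (subst sum.swap) (simp add: sum_distrib_left)
  also have "(\<Sum>i<M. w ^ (M - Suc i) * (\<Sum>k = - int m..int m. (\<omega> ^ i) powi k))
      = (\<Sum>i<M. if i = 0 then of_nat M * w ^ (2 * m) else 0)"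
    using inner by (intro sum.cong) (auto simp: M_def)
  also have "\<dots> = of_nat M * w ^ (2 * m)"
    by (simp add: M_def)
  finally show ?thesis
    by (simp add: M_def)
qed

lemma neg_cis_powi:
  "(- cis x) powi k = (-1) powi k * cis (of_int k * x)"
proof -
  have "(- cis x) powi k = (-1) powi k * cis x powi k"
    by (metis mult_minus1 power_int_mult_distrib)
  also have "cis x powi k = cis (of_int k * x)"
    by (simp add: cis_power_int)
  finally show ?thesis .
qed

text \<open>
  Oddness of \<open>M\<close> makes the sign cancel \<open>cis pi = -1\<close>. No smaller positive power is 1, because its
  imaginary part \<open>\<plusminus> sin (i * pi / M)\<close> does not vanish.
\<close>
lemma neg_cis_primitive_root:
  assumes "odd M"
  shows "(- cis (pi / real M)) ^ M = 1"
    and "0 < i \<Longrightarrow> i < M \<Longrightarrow> (- cis (pi / real M)) ^ i \<noteq> 1"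
proof -
  show "(- cis (pi / real M)) ^ M = 1"
    by (simp only: power_minus[of "cis _"] DeMoivre) (use assms in \<open>auto elim: oddE\<close>)
next
  assume i: "0 < i" "i < M"
  define x where "x = real i * (pi / real M)"
  have "0 < x" "x < pi"
    using i by (simp_all add: x_def field_simps)
  then have "sin x > 0"
    by (rule sin_gt_zero)
  moreover have "Im ((- cis (pi / real M)) ^ i) = (-1) ^ i * sin x"
    by (cases "even i") (simp_all add: x_def DeMoivre)
  ultimately show "(- cis (pi / real M)) ^ i \<noteq> 1"
    by auto
qed

section \<open>Partial fractions of the hyperbolic secant\<close>

text \<open>
  For a root of unity \<open>z\<close> with real part \<open>e\<close>, the quadratic \<open>z\<^sup>2 + 2 * \<i> * sinh t * z + 1\<close>
  equals \<open>2 * z * (e + \<i> * sinh t)\<close>, and as a polynomial in \<open>z\<close> it has the zeros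
  \<open>r = \<i> * exp (- t)\<close> and \<open>s = - \<i> * exp t\<close>. Hence \<open>cosh t / (e + \<i> * sinh t)\<close>, whose real part is
  \<open>e * cosh t / ((sinh t)\<^sup>2 + e\<^sup>2)\<close>, splits into terms with denominators \<open>s - z\<close> and \<open>r - z\<close>, to
  which the sum over roots of unity applies. As \<open>M\<close> is odd, \<open>r ^ M\<close> and \<open>s ^ M\<close> are purely
  imaginary; in particular they are never 1.
\<close>
lemma partial_fractions_sech:
  fixes t :: real
  shows "(\<Sum>k = - int m..int m. (-1) powi (int m + k) * cos (pi * of_int k / (2 * of_nat m + 1)) * cosh t
            / ((sinh t)\<^sup>2 + (cos (pi * of_int k / (2 * of_nat m + 1)))\<^sup>2))
         = real (2 * m + 1) / cosh (real (2 * m + 1) * t)"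
proof -
  define M where "M = 2 * m + 1"
  have "odd M"
    by (simp add: M_def)
  define \<omega> where "\<omega> = - cis (pi / real M)"
  define \<sigma> :: real where "\<sigma> = (-1) ^ m"
  define r s where "r = \<i> * of_real (exp (- t))" and "s = - \<i> * of_real (exp t)"
  define E where "E = exp (real M * t)"
  have E: "E > 0"
    by (simp add: E_def)
  have \<sigma>2: "\<sigma> * \<sigma> = 1"
    by (simp add: \<sigma>_def flip: power_mult_distrib)
  have iM: "\<i> ^ M = \<i> * of_real \<sigma>"
    by (simp add: M_def \<sigma>_def power_mult)
  have expM: "exp t ^ M = E" "exp (- t) ^ M = 1 / E"
    by (simp_all add: E_def exp_minus divide_inverse power_inverse flip: exp_of_nat_mult)
  have sM: "s ^ M = - \<i> * of_real (\<sigma> * E)"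
    unfolding s_def power_mult_distrib of_real_power[symmetric] expM
    using \<open>odd M\<close> by (simp add: iM)
  have rM: "r ^ M = \<i> * of_real (\<sigma> / E)"
    unfolding r_def power_mult_distrib of_real_power[symmetric] expM
    by (simp add: iM)
  have rM1: "r ^ M \<noteq> 1" and sM1: "s ^ M \<noteq> 1"
    by (simp_all add: rM sM complex_eq_iff)
  note root = neg_cis_primitive_root[OF \<open>odd M\<close>, folded \<omega>_def]
  have split: "(-1) powi k * cos (pi * of_int k / M) * cosh t / ((sinh t)\<^sup>2 + (cos (pi * of_int k / M))\<^sup>2)
      = Im (s * (1 / (s - \<omega> powi k)) - r * (1 / (r - \<omega> powi k)))" for k
  proof -
    define z where "z = \<omega> powi k"
    define e where "e = Re z"
    define d where "d = cos (pi * of_int k / M)"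
    have z: "z = (-1) powi k * cis (of_int k * (pi / real M))"
      unfolding z_def \<omega>_def by (rule neg_cis_powi)
    have e: "e = (-1) powi k * d"
      by (cases "even k") (simp_all add: e_def z d_def mult_ac)
    have nz: "norm z = 1"
      by (cases "even k") (simp_all add: z norm_mult)
    have zM: "z ^ M = 1"
      by (metis root(1) power_int_1_left power_int_mult power_int_of_nat mult.commute z_def)
    have zr: "z \<noteq> r" and zs: "z \<noteq> s"
      using zM rM1 sM1 by auto
    have quad: "z\<^sup>2 + 1 = 2 * of_real e * z"
    proof -
      have "z * cnj z = 1"
        using nz by (simp add: complex_mult_cnj flip: cmod_power2)
      then have "z\<^sup>2 + 1 = z * (z + cnj z)"
        by (simp add: algebra_simps power2_eq_square)
      then show ?thesis
        by (simp add: complex_add_cnj e_def)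
    qed
    have rs: "r * s = 1" "r + s = - 2 * \<i> * of_real (sinh t)" "r - s = 2 * \<i> * of_real (cosh t)"
      by (simp_all add: r_def s_def exp_minus sinh_def cosh_def algebra_simps)
    have "(s - z) * (r - z) = (z\<^sup>2 + 1) - (r + s) * z + (r * s - 1)"
      by (simp add: algebra_simps power2_eq_square)
    then have prod: "(s - z) * (r - z) = 2 * z * (of_real e + \<i> * of_real (sinh t))"
      unfolding quad rs by (simp add: algebra_simps)
    have "s * (1 / (s - z)) - r * (1 / (r - z)) = z * (r - s) / ((s - z) * (r - z))"
      using zr zs by (simp add: divide_simps) (simp add: algebra_simps)
    also have "z * (r - s) = (2 * z) * (\<i> * of_real (cosh t))"
      by (simp add: rs)
    also have "(2 * z) * (\<i> * of_real (cosh t)) / ((s - z) * (r - z))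
        = \<i> * of_real (cosh t) / (of_real e + \<i> * of_real (sinh t))"
      unfolding prod by (rule mult_divide_mult_cancel_left) (use nz in auto)
    also have "Im \<dots> = e * cosh t / ((sinh t)\<^sup>2 + e\<^sup>2)"
      by (simp add: Im_divide add.commute mult.commute)
    also have "e\<^sup>2 = d\<^sup>2"
      by (cases "even k") (simp_all add: e)
    finally show ?thesis
      by (simp add: e d_def z_def)
  qed
  have sumw: "(\<Sum>k = - int m..int m. w * (1 / (w - \<omega> powi k))) = of_nat M * (w ^ M / (w ^ M - 1))"
    if "w ^ M \<noteq> 1" for w
  proof -
    have "(\<Sum>k = - int m..int m. w * (1 / (w - \<omega> powi k))) = w * (\<Sum>k = - int m..int m. 1 / (w - \<omega> powi k))"
      by (simp only: sum_distrib_left)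
    also have "(\<Sum>k = - int m..int m. 1 / (w - \<omega> powi k)) = of_nat M * w ^ (2 * m) / (w ^ M - 1)"
      unfolding M_def using root that by (intro sum_inverse_diff_roots_of_unity) (auto simp: M_def)
    finally show ?thesis
      by (simp add: M_def)
  qed
  have "(\<Sum>k = - int m..int m. (-1) powi (int m + k) * cos (pi * of_int k / M) * cosh t
            / ((sinh t)\<^sup>2 + (cos (pi * of_int k / M))\<^sup>2))
      = \<sigma> * (\<Sum>k = - int m..int m. (-1) powi k * cos (pi * of_int k / M) * cosh t
            / ((sinh t)\<^sup>2 + (cos (pi * of_int k / M))\<^sup>2))"
    by (simp add: sum_distrib_left \<sigma>_def power_int_add mult_ac)
  also have "\<dots> = \<sigma> * Im (of_nat M * (s ^ M / (s ^ M - 1)) - of_nat M * (r ^ M / (r ^ M - 1)))"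
    unfolding split sumw[OF rM1, symmetric] sumw[OF sM1, symmetric] by (simp add: sum_subtractf)
  also have "\<dots> = real M * (\<sigma> * (Im (s ^ M / (s ^ M - 1)) - Im (r ^ M / (r ^ M - 1))))"
  proof -
    have "\<sigma> * Im (of_nat M * x - of_nat M * y) = real M * (\<sigma> * (Im x - Im y))" for x y
      by (simp add: algebra_simps)
    then show ?thesis .
  qed
  also have "Im (s ^ M / (s ^ M - 1)) = \<sigma> * E / (1 + E\<^sup>2)"
    using E \<sigma>2 by (simp add: sM Im_divide power2_eq_square field_simps)
  also have "Im (r ^ M / (r ^ M - 1)) = - \<sigma> * E / (1 + E\<^sup>2)"
    using E \<sigma>2 by (simp add: rM Im_divide power2_eq_square field_simps)
  also have "\<sigma> * (\<sigma> * E / (1 + E\<^sup>2) - - \<sigma> * E / (1 + E\<^sup>2)) = 2 * E / (1 + E\<^sup>2)"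
    using \<sigma>2 by (simp add: field_simps)
  also have "\<dots> = 1 / cosh (real M * t)"
    using E unfolding cosh_def exp_minus E_def[symmetric] by (simp add: field_simps power2_eq_square)
  finally show ?thesis
    by (simp add: M_def add.commute)
qed

section \<open>Expansion of the arctangent of a power\<close>

lemma cos_pos_symmetric:
  assumes "k \<in> {- int m..int m}"
  shows "cos (pi * of_int k / (2 * of_nat m + 1)) > 0"
proof -
  have "real_of_int (- int m) \<le> of_int k" "real_of_int k \<le> of_int (int m)"
    using assms unfolding of_int_le_iff by simp_all
  then have "- (2 * real m + 1) < 2 * of_int k" "2 * of_int k < 2 * real m + 1"
    by simp_all
  then have "pi * (- (2 * real m + 1)) < pi * (2 * of_int k)" "pi * (2 * of_int k) < pi * (2 * real m + 1)"
    by (simp_all only: mult_less_cancel_left_pos pi_gt_zero)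
  then show ?thesis
    by (intro cos_gt_zero_pi) (simp_all add: field_simps)
qed

text \<open>
  The left side has derivative \<open>- M / (2 * cosh (M * t))\<close>, and the term \<open>arctan (sinh t / d)\<close> has
  derivative \<open>d * cosh t / ((sinh t)\<^sup>2 + d\<^sup>2)\<close>, so the partial fractions of the hyperbolic secant
  show that the difference of the two sides is constant; at \<open>t = 0\<close> it vanishes.
\<close>
lemma arctan_exp_expansion:
  fixes t :: real
  shows "arctan (exp (- (real (2 * m + 1) * t))) = pi / 4 -
     (\<Sum>k = - int m..int m. (-1) powi (int m + k) * arctan (sinh t / cos (pi * of_int k / (2 * of_nat m + 1)))) / 2"
proof -
  define d where "d = (\<lambda>k::int. cos (pi * of_int k / (2 * real m + 1)))"
  define M where "M = real (2 * m + 1)"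
  define F where "F = (\<lambda>t. arctan (exp (- (M * t))) +
     (\<Sum>k = - int m..int m. (-1) powi (int m + k) * arctan (sinh t / d k)) / 2)"
  have dpos: "d k > 0" if "k \<in> {- int m..int m}" for k
    using cos_pos_symmetric[OF that] by (simp add: d_def)
  have "(F has_real_derivative 0) (at t)" for t
  proof -
    have 1: "((\<lambda>t. arctan (exp (- (M * t)))) has_real_derivative - (M / cosh (M * t)) / 2) (at t)"
    proof -
      have "1 + exp (M * t) * exp (M * t) > 0" "2 + 2 * (exp (M * t) * exp (M * t)) > 0"
        by (simp_all add: add_pos_pos)
      then show ?thesis
        by (auto intro!: derivative_eq_intros simp: cosh_def exp_minus field_simps power2_eq_square)
    qed
    have 2: "((\<lambda>t. arctan (sinh t / d k)) has_real_derivative d k * cosh t / ((sinh t)\<^sup>2 + (d k)\<^sup>2)) (at t)"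
      if "k \<in> {- int m..int m}" for k
    proof -
      have "(sinh t)\<^sup>2 + (d k)\<^sup>2 > 0"
        using dpos[OF that] by (simp add: add_nonneg_pos)
      then show ?thesis
        using dpos[OF that]
        by (auto intro!: derivative_eq_intros simp: field_simps power2_eq_square)
    qed
    have "(F has_real_derivative - (M / cosh (M * t)) / 2 +
        (\<Sum>k = - int m..int m. (-1) powi (int m + k) * (d k * cosh t / ((sinh t)\<^sup>2 + (d k)\<^sup>2))) / 2) (at t)"
      unfolding F_def by (intro DERIV_add 1 DERIV_cdivide DERIV_sum DERIV_cmult 2)
    then show ?thesis
      using partial_fractions_sech[of m t] by (simp add: d_def M_def mult_ac)
  qed
  then have "F t = F 0"
    by (intro DERIV_isconst_all) auto
  also have "F 0 = pi / 4"
    by (simp add: F_def arctan_one)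
  finally show ?thesis
    by (simp add: F_def d_def M_def)
qed

lemma arctan_radical_expansion:
  fixes y :: real
  shows "arctan ((sqrt (1 + y\<^sup>2) - y) ^ (2 * m + 1)) = pi / 4 -
     (\<Sum>k = - int m..int m. (-1) powi (int m + k) * arctan (y / cos (pi * of_int k / (2 * of_nat m + 1)))) / 2"
proof -
  define t where "t = arsinh y"
  have y: "sinh t = y"
    by (simp add: t_def)
  have "sqrt (1 + y\<^sup>2) - y = cosh t - sinh t"
    by (simp add: y t_def cosh_arsinh_real add.commute)
  also have "\<dots> = exp (- t)"
    by (rule cosh_minus_sinh)
  finally have "(sqrt (1 + y\<^sup>2) - y) ^ (2 * m + 1) = exp (- (real (2 * m + 1) * t))"
    by (simp only: exp_of_nat_mult mult_minus_right[symmetric])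
  then show ?thesis
    using arctan_exp_expansion[of m t] by (simp only: y)
qed

section \<open>The reciprocity formula\<close>

theorem theorem1:
  fixes n m :: nat and \<alpha> \<beta> :: real
  assumes "\<alpha> > 0" and "\<alpha> * \<beta> = 1"
  shows
    "(\<Sum>j::int = - int n..int n. (-1) powi (int n + j) *
        arctan ((sqrt (1 + \<alpha>\<^sup>2 * (cos (pi * of_int j / (2 * of_nat n + 1)))\<^sup>2)
                  - \<alpha> * cos (pi * of_int j / (2 * of_nat n + 1))) ^ (2 * m + 1)))
   + (\<Sum>k::int = - int m..int m. (-1) powi (int m + k) *
        arctan ((sqrt (1 + \<beta>\<^sup>2 * (cos (pi * of_int k / (2 * of_nat m + 1)))\<^sup>2)
                  - \<beta> * cos (pi * of_int k / (2 * of_nat m + 1))) ^ (2 * n + 1)))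
   = pi / 4"
proof -
  define c where "c = (\<lambda>j::int. cos (pi * of_int j / (2 * real n + 1)))"
  define d where "d = (\<lambda>k::int. cos (pi * of_int k / (2 * real m + 1)))"
  define p q where "p = (\<lambda>j::int. (-1 :: real) powi (int n + j))"
    and "q = (\<lambda>k::int. (-1 :: real) powi (int m + k))"
  let ?J = "{- int n..int n}" and ?K = "{- int m..int m}"
  have \<beta>: "\<beta> = 1 / \<alpha>"
    using assms by (simp add: field_simps)
  have sum_p: "(\<Sum>j\<in>?J. p j) = 1" and sum_q: "(\<Sum>k\<in>?K. q k) = 1"
    unfolding p_def q_def by (rule sum_alternating_symmetric)+
  have complementary: "arctan (\<alpha> * c j / d k) + arctan (\<beta> * d k / c j) = pi / 2"
    if "j \<in> ?J" "k \<in> ?K" for j k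
  proof -
    define x where "x = \<alpha> * c j / d k"
    have x: "x > 0"
      using assms(1) cos_pos_symmetric[OF that(1)] cos_pos_symmetric[OF that(2)]
      by (simp add: x_def c_def d_def)
    have "\<beta> * d k / c j = 1 / x"
      by (simp add: x_def \<beta> field_simps)
    moreover have "arctan x + arctan (1 / x) = pi / 2"
      using arctan_inverse[of x] x by simp
    ultimately show ?thesis
      by (simp only: x_def)
  qed
  have first: "(\<Sum>j\<in>?J. p j * arctan ((sqrt (1 + \<alpha>\<^sup>2 * (c j)\<^sup>2) - \<alpha> * c j) ^ (2 * m + 1)))
      = pi / 4 - (\<Sum>j\<in>?J. \<Sum>k\<in>?K. p j * q k * arctan (\<alpha> * c j / d k)) / 2"
  proof -
    have "p j * arctan ((sqrt (1 + \<alpha>\<^sup>2 * (c j)\<^sup>2) - \<alpha> * c j) ^ (2 * m + 1))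
        = p j * (pi / 4) - (\<Sum>k\<in>?K. p j * q k * arctan (\<alpha> * c j / d k)) / 2" for j
      using arctan_radical_expansion[of "\<alpha> * c j" m]
      by (simp add: power_mult_distrib q_def d_def sum_distrib_left right_diff_distrib mult.assoc)
    then show ?thesis
      by (simp only: sum_subtractf sum_distrib_right[symmetric] sum_divide_distrib[symmetric] sum_p mult_1_left)
  qed
  have second: "(\<Sum>k\<in>?K. q k * arctan ((sqrt (1 + \<beta>\<^sup>2 * (d k)\<^sup>2) - \<beta> * d k) ^ (2 * n + 1)))
      = pi / 4 - (\<Sum>j\<in>?J. \<Sum>k\<in>?K. p j * q k * arctan (\<beta> * d k / c j)) / 2"
  proof -
    have "q k * arctan ((sqrt (1 + \<beta>\<^sup>2 * (d k)\<^sup>2) - \<beta> * d k) ^ (2 * n + 1))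
        = q k * (pi / 4) - (\<Sum>j\<in>?J. p j * q k * arctan (\<beta> * d k / c j)) / 2" for k
      using arctan_radical_expansion[of "\<beta> * d k" n]
      by (simp add: power_mult_distrib p_def c_def sum_distrib_left right_diff_distrib mult_ac)
    then show ?thesis
      by (simp only: sum_subtractf sum_distrib_right[symmetric] sum_divide_distrib[symmetric] sum_q mult_1_left
          sum.swap[of _ ?J ?K])
  qed
  have "(\<Sum>j\<in>?J. \<Sum>k\<in>?K. p j * q k * arctan (\<alpha> * c j / d k))
      + (\<Sum>j\<in>?J. \<Sum>k\<in>?K. p j * q k * arctan (\<beta> * d k / c j))
      = (\<Sum>j\<in>?J. \<Sum>k\<in>?K. p j * q k * (pi / 2))"
    by (simp only: sum.distrib[symmetric] distrib_left[symmetric])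
      (intro sum.cong refl arg_cong2[of _ _ _ _ "(*)"] complementary)
  also have "\<dots> = (\<Sum>j\<in>?J. p j) * (\<Sum>k\<in>?K. q k) * (pi / 2)"
    by (subst sum_product) (simp only: sum_distrib_right)
  also have "\<dots> = pi / 2"
    by (simp add: sum_p sum_q)
  finally have "(\<Sum>j\<in>?J. p j * arctan ((sqrt (1 + \<alpha>\<^sup>2 * (c j)\<^sup>2) - \<alpha> * c j) ^ (2 * m + 1)))
      + (\<Sum>k\<in>?K. q k * arctan ((sqrt (1 + \<beta>\<^sup>2 * (d k)\<^sup>2) - \<beta> * d k) ^ (2 * n + 1))) = pi / 4"
    using first second by argo
  then show ?thesis
    by (simp only: p_def q_def c_def d_def)
qed

end
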